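(* A compact Hausdorff space $K$ is homeomorphic to the Higson compactification of some finitary coarse space if $K$ is Fréchet–Urysohn and has dense set of isolated points.
   Context: An entourage on a set $X$ is a subset $E\subseteq X\times X$ containing the diagonal $\Delta_X$; $E^{-1}=\{(y,x):(x,y)\in E\}$, $E\circ F=\{(x,z):\exists y\in X,\ (x,y)\in E,\ (y,z)\in F\}$, $E[x]=\{y\in X:(x,y)\in E\}$. A coarse space $(X,\mathcal E)$ is a set $X$ with a family $\mathcal E$ of entourages such that $\bigcup\mathcal E=X\times X$; for all $E,F\in\mathcal E$ there is $G\in\mathcal E$ with $E\circ F^{-1}\subseteq G$; and $\Delta_X\subseteq E\subseteq F\in\mathcal E$ implies $E\in\mathcal E$. A set $B\subseteq X$ is bounded if $B\subseteq E[x]$ for some $E\in\mathcal E$, $x\in X$. The coarse space is finitary if $\sup_{x\in X}|E[x]|$ is finite for every $E\in\mathcal E$. A function $\varphi:X\to\mathbb R$ is slowly oscillating if for every $\varepsilon>0$ and $E\in\mathcal E$ there is a bounded set $B\subseteq X$ with $\mathrm{diam}\,\varphi(E[x])<\varepsilon$ for all $x\in X\setminus B$. Let $\mathsf{so}(X,\mathcal E;\mathbb R)$ be the set of all bounded slowly oscillating functions $X\to\mathbb R$. The Higson compactification of $(X,\mathcal E)$ is the closure of the image of the map $X\to\mathbb R^{\mathsf{so}(X,\mathcal E;\mathbb R)}$, $x\mapsto(f(x))_f$ (product topology). A topological space $X$ is Fréchet–Urysohn if for any $A\subseteq X$ and $x\in\bar A\setminus A$ there exists a sequence of points of $A$ that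 converges to $x$. *)

theory Defs
  imports "HOL-Analysis.Analysis"
begin

section \<open>Coarse spaces\<close>

definition entourage :: "'a set \<Rightarrow> ('a \<times> 'a) set \<Rightarrow> bool" where
  "entourage X E \<longleftrightarrow> Id_on X \<subseteq> E \<and> E \<subseteq> X \<times> X"

text \<open>The composition \<open>E \<circ> F\<close> of entourages is \<^term>\<open>E O F\<close>, and \<open>E[x]\<close> is \<^term>\<open>E `` {x}\<close>.\<close>

definition coarse_space :: "'a set \<Rightarrow> ('a \<times> 'a) set set \<Rightarrow> bool" where
  "coarse_space X \<E> \<longleftrightarrow>
     (\<forall>E\<in>\<E>. entourage X E) \<and>
     \<Union>\<E> = X \<times> X \<and>
     (\<forall>E\<in>\<E>. \<forall>F\<in>\<E>. \<exists>G\<in>\<E>. E O F\<inverse> \<subseteq> G) \<and>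
     (\<forall>E. \<forall>F\<in>\<E>. Id_on X \<subseteq> E \<and> E \<subseteq> F \<longrightarrow> E \<in> \<E>)"

definition coarsely_bounded :: "'a set \<Rightarrow> ('a \<times> 'a) set set \<Rightarrow> 'a set \<Rightarrow> bool" where
  "coarsely_bounded X \<E> B \<longleftrightarrow> B \<subseteq> X \<and> (\<exists>E\<in>\<E>. \<exists>x\<in>X. B \<subseteq> E `` {x})"

definition finitary :: "'a set \<Rightarrow> ('a \<times> 'a) set set \<Rightarrow> bool" where
  "finitary X \<E> \<longleftrightarrow>
     (\<forall>E\<in>\<E>. \<exists>n. \<forall>x\<in>X. finite (E `` {x}) \<and> card (E `` {x}) \<le> n)"


section \<open>The Higson compactification\<close>

text \<open>
  \<^const>\<open>diameter\<close> is meaningful only on metrically bounded sets, so the requirement that the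
  diameter be finite is stated separately.
\<close>

definition slowly_oscillating ::
    "'a set \<Rightarrow> ('a \<times> 'a) set set \<Rightarrow> ('a \<Rightarrow> real) \<Rightarrow> bool" where
  "slowly_oscillating X \<E> \<phi> \<longleftrightarrow>
     (\<forall>\<epsilon>>0. \<forall>E\<in>\<E>. \<exists>B. coarsely_bounded X \<E> B \<and>
        (\<forall>x\<in>X - B. bounded (\<phi> ` (E `` {x})) \<and> diameter (\<phi> ` (E `` {x})) < \<epsilon>))"

text \<open>
  Functions \<open>X \<rightarrow> \<real>\<close> are represented by the functions that are \<^const>\<open>extensional\<close> on \<open>X\<close>, so that
  each of them occurs exactly once as a coordinate of the product below.
\<close>

definition so_functions :: "'a set \<Rightarrow> ('a \<times> 'a) set set \<Rightarrow> ('a \<Rightarrow> real) set" where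
  "so_functions X \<E> = {f \<in> extensional X. bounded (f ` X) \<and> slowly_oscillating X \<E> f}"

definition higson_map ::
    "'a set \<Rightarrow> ('a \<times> 'a) set set \<Rightarrow> 'a \<Rightarrow> (('a \<Rightarrow> real) \<Rightarrow> real)" where
  "higson_map X \<E> x = (\<lambda>f\<in>so_functions X \<E>. f x)"

definition higson_compactification ::
    "'a set \<Rightarrow> ('a \<times> 'a) set set \<Rightarrow> (('a \<Rightarrow> real) \<Rightarrow> real) topology" where
  "higson_compactification X \<E> =
     (let P = product_topology (\<lambda>_. euclideanreal) (so_functions X \<E>)
      in subtopology P (P closure_of (higson_map X \<E> ` X)))"


section \<open>Topological notions\<close>

definition frechet_urysohn_space :: "'a topology \<Rightarrow> bool" where
  "frechet_urysohn_space K \<longleftrightarrow>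
     (\<forall>A x. A \<subseteq> topspace K \<and> x \<in> K closure_of A - A \<longrightarrow>
        (\<exists>\<sigma>::nat \<Rightarrow> 'a. range \<sigma> \<subseteq> A \<and> limitin K \<sigma> x sequentially))"

definition isolated_points :: "'a topology \<Rightarrow> 'a set" where
  "isolated_points K = {x \<in> topspace K. openin K {x}}"

end

theory Submission
  imports Defs
begin

text \<open>
  Let \<open>X\<close> be the set of isolated points of \<open>K\<close>. As coarse structure on \<open>X\<close> take the largest finitary
  one for which every continuous function on \<open>K\<close> oscillates slowly: the entourages \<open>E\<close> with
  \<open>E\<close> and \<open>E\<inverse>\<close> uniformly locally finite, such that for every continuous \<open>g : K \<rightarrow> \<real>\<close> and \<open>\<epsilon> > 0\<close>
  only finitely many pairs \<open>(x, y) \<in> E\<close> satisfy \<open>\<bar>g x - g y\<bar> \<ge> \<epsilon>\<close> (\<open>small_at_infinity\<close>). For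
  nonempty \<open>X\<close>, its bounded sets are the finite ones: a finite number of pairs may be added to any
  entourage, and balls are finite.

  The point is that, conversely, every bounded slowly oscillating \<open>\<phi> : X \<rightarrow> \<real>\<close> extends continuously
  to \<open>K\<close>. Otherwise, at some \<open>p \<in> K - X\<close>, the point \<open>p\<close> lies in the closure of two sets on which the
  values of \<open>\<phi>\<close> are at least \<open>\<delta> > 0\<close> apart. By the Frechet--Urysohn property, there are sequences
  \<open>a\<^sub>n\<close> and \<open>b\<^sub>n\<close> in these sets that converge to \<open>p\<close>, and since \<open>p \<notin> X\<close> they may be taken
  injective. Then the diagonal together with the pairs \<open>(a\<^sub>n, b\<^sub>n)\<close> is an entourage
  (\<open>paired_sequences_entourage\<close>), so \<open>\<phi> a\<^sub>n - \<phi> b\<^sub>n\<close> must tend to \<open>0\<close>, which is absurd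
  (\<open>slowly_oscillating_limit\<close>).

  As \<open>X\<close> is dense, restriction thus identifies the continuous functions on \<open>K\<close> with the bounded
  slowly oscillating functions on \<open>X\<close>. Mapping a point of \<open>K\<close> to the values of all the extensions
  embeds the compact space \<open>K\<close> into the product, and the image of \<open>K\<close> is the closure of the image
  of \<open>X\<close>.
\<close>

section \<open>The coarse structure\<close>

definition uniformly_finite_on :: "'a set \<Rightarrow> ('a \<times> 'a) set \<Rightarrow> bool" where
  "uniformly_finite_on X E \<longleftrightarrow> (\<exists>n. \<forall>x\<in>X. finite (E `` {x}) \<and> card (E `` {x}) \<le> n)"

definition small_at_infinity :: "'a topology \<Rightarrow> ('a \<times> 'a) set \<Rightarrow> bool" where
  "small_at_infinity K E \<longleftrightarrow>
     (\<forall>g. continuous_map K euclideanreal g \<longrightarrow>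
        (\<forall>\<epsilon>>0. finite {(x, y). (x, y) \<in> E \<and> \<epsilon> \<le> \<bar>g x - g y\<bar>}))"

text \<open>
  Finitariness is required of the converse as well because the converses of entourages have to be
  entourages.
\<close>

definition small_entourages :: "'a topology \<Rightarrow> 'a set \<Rightarrow> ('a \<times> 'a) set set" where
  "small_entourages K X =
     {E. entourage X E \<and> uniformly_finite_on X E \<and> uniformly_finite_on X (E\<inverse>) \<and> small_at_infinity K E}"

lemma uniformly_finite_on_subset:
  assumes "uniformly_finite_on X F" "E \<subseteq> F"
  shows "uniformly_finite_on X E"
proof -
  obtain n where n: "\<And>x. x \<in> X \<Longrightarrow> finite (F `` {x}) \<and> card (F `` {x}) \<le> n"
    using assms(1) unfolding uniformly_finite_on_def by blast
  have "finite (E `` {x}) \<and> card (E `` {x}) \<le> n" if "x \<in> X" for x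
  proof -
    have "E `` {x} \<subseteq> F `` {x}"
      using assms(2) by blast
    then show ?thesis
      using n[OF that] by (meson card_mono finite_subset order_trans)
  qed
  then show ?thesis
    unfolding uniformly_finite_on_def by blast
qed

lemma uniformly_finite_on_relcomp:
  assumes "uniformly_finite_on X E" "uniformly_finite_on X F" "E \<subseteq> X \<times> X"
  shows "uniformly_finite_on X (E O F)"
proof -
  obtain m where m: "\<And>x. x \<in> X \<Longrightarrow> finite (E `` {x}) \<and> card (E `` {x}) \<le> m"
    using assms(1) unfolding uniformly_finite_on_def by blast
  obtain n where n: "\<And>x. x \<in> X \<Longrightarrow> finite (F `` {x}) \<and> card (F `` {x}) \<le> n"
    using assms(2) unfolding uniformly_finite_on_def by blast
  have "finite ((E O F) `` {x}) \<and> card ((E O F) `` {x}) \<le> m * n" if "x \<in> X" for x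
  proof -
    have eq: "(E O F) `` {x} = (\<Union>y\<in>E `` {x}. F `` {y})"
      by auto
    have sub: "E `` {x} \<subseteq> X"
      using assms(3) by auto
    have "card (\<Union>y\<in>E `` {x}. F `` {y}) \<le> (\<Sum>y\<in>E `` {x}. card (F `` {y}))"
      using m[OF that] by (intro card_UN_le) auto
    also have "\<dots> \<le> (\<Sum>y\<in>E `` {x}. n)"
      using n sub by (intro sum_mono) auto
    also have "\<dots> \<le> m * n"
      using m[OF that] by simp
    finally show ?thesis
      unfolding eq using m[OF that] n sub by auto
  qed
  then show ?thesis
    unfolding uniformly_finite_on_def by blast
qed

lemma small_at_infinityD:
  assumes "small_at_infinity K E" "continuous_map K euclideanreal g" "\<epsilon> > 0"
  shows "finite {(x, y). (x, y) \<in> E \<and> \<epsilon> \<le> \<bar>g x - g y\<bar>}"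
  using assms by (simp add: small_at_infinity_def)

lemma small_at_infinity_converse:
  assumes "small_at_infinity K E"
  shows "small_at_infinity K (E\<inverse>)"
  unfolding small_at_infinity_def
proof (intro allI impI)
  fix g and \<epsilon> :: real
  assume "continuous_map K euclideanreal g" "\<epsilon> > 0"
  then have "finite ({(x, y). (x, y) \<in> E \<and> \<epsilon> \<le> \<bar>g x - g y\<bar>}\<inverse>)"
    using assms by (simp add: small_at_infinity_def)
  then show "finite {(x, y). (x, y) \<in> E\<inverse> \<and> \<epsilon> \<le> \<bar>g x - g y\<bar>}"
    by (rule rev_finite_subset) (auto simp: abs_minus_commute)
qed

text \<open>
  If \<open>g\<close> changes by at least \<open>\<epsilon>\<close> along a pair of the composition, it changes by at least \<open>\<epsilon>/2\<close>
  along one of the two steps. There are finitely many such steps, and local finiteness of \<open>E\<inverse>\<close> and \<open>F\<close> leaves finitely many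
  ways to complete each of them to a pair of the composition.
\<close>

lemma small_at_infinity_relcomp:
  assumes E: "small_at_infinity K E" "uniformly_finite_on X (E\<inverse>)" "E \<subseteq> X \<times> X"
    and F: "small_at_infinity K F" "uniformly_finite_on X F" "F \<subseteq> X \<times> X"
  shows "small_at_infinity K (E O F)"
  unfolding small_at_infinity_def
proof (intro allI impI)
  fix g and \<epsilon> :: real
  assume g: "continuous_map K euclideanreal g" and "\<epsilon> > 0"
  let ?big = "\<lambda>R. {(x, y). (x, y) \<in> R \<and> \<epsilon> / 2 \<le> \<bar>g x - g y\<bar>}"
  have fin: "finite (?big E)" "finite (?big F)"
    using small_at_infinityD[OF E(1) g half_gt_zero] small_at_infinityD[OF F(1) g half_gt_zero] \<open>\<epsilon> > 0\<close>
    by blast+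
  let ?S = "(\<Union>(x, y)\<in>?big E. {x} \<times> F `` {y}) \<union> (\<Union>(y, z)\<in>?big F. E\<inverse> `` {y} \<times> {z})"
  have "finite (F `` {y})" "finite (E\<inverse> `` {y})" if "y \<in> X" for y
    using that E(2) F(2) by (auto simp: uniformly_finite_on_def)
  then have "finite ?S"
    using fin E(3) F(3) by (intro finite_UnI finite_UN_I) auto
  moreover have "{(x, z). (x, z) \<in> E O F \<and> \<epsilon> \<le> \<bar>g x - g z\<bar>} \<subseteq> ?S"
  proof clarify
    fix x y z
    assume xyz: "(x, y) \<in> E" "(y, z) \<in> F" "\<epsilon> \<le> \<bar>g x - g z\<bar>"
      and no: "(x, z) \<notin> (\<Union>(y, z)\<in>?big F. E\<inverse> `` {y} \<times> {z})"
    have "\<not> \<epsilon> / 2 \<le> \<bar>g y - g z\<bar>"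
      using no xyz by auto
    then have "\<epsilon> / 2 \<le> \<bar>g x - g y\<bar>"
      using xyz(3) by linarith
    then show "(x, z) \<in> (\<Union>(x, y)\<in>?big E. {x} \<times> F `` {y})"
      using xyz by auto
  qed
  ultimately show "finite {(x, z). (x, z) \<in> E O F \<and> \<epsilon> \<le> \<bar>g x - g z\<bar>}"
    by (rule rev_finite_subset)
qed

lemma finite_Un_Id_on_small_entourages:
  assumes "finite D" "D \<subseteq> X \<times> X"
  shows "Id_on X \<union> D \<in> small_entourages K X"
proof -
  have uf: "uniformly_finite_on X (Id_on X \<union> R)" if "finite R" for R :: "('a \<times> 'a) set"
    unfolding uniformly_finite_on_def
  proof (intro exI ballI conjI)
    fix x assume "x \<in> X"
    have sub: "(Id_on X \<union> R) `` {x} \<subseteq> insert x (snd ` R)"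
      by force
    show "finite ((Id_on X \<union> R) `` {x})"
      using sub that by (meson finite.insertI finite_imageI finite_subset)
    have "card ((Id_on X \<union> R) `` {x}) \<le> card (insert x (snd ` R))"
      using sub that by (simp add: card_mono)
    also have "\<dots> \<le> Suc (card (snd ` R))"
      by (rule card_insert_le_m1) auto
    finally show "card ((Id_on X \<union> R) `` {x}) \<le> Suc (card (snd ` R))" .
  qed
  have "(Id_on X \<union> D)\<inverse> = Id_on X \<union> D\<inverse>"
    by auto
  moreover have "small_at_infinity K (Id_on X \<union> D)"
    unfolding small_at_infinity_def
  proof (intro allI impI)
    fix g and \<epsilon> :: real
    assume "\<epsilon> > 0"
    then show "finite {(x, y). (x, y) \<in> Id_on X \<union> D \<and> \<epsilon> \<le> \<bar>g x - g y\<bar>}"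
      by (intro finite_subset[OF _ assms(1)]) auto
  qed
  ultimately show ?thesis
    using uf assms by (auto simp: small_entourages_def entourage_def)
qed

lemma coarse_space_small_entourages: "coarse_space X (small_entourages K X)"
  unfolding coarse_space_def
proof (intro conjI ballI allI impI)
  show "entourage X E" if "E \<in> small_entourages K X" for E
    using that by (simp add: small_entourages_def)
  show "\<Union>(small_entourages K X) = X \<times> X"
  proof
    show "\<Union>(small_entourages K X) \<subseteq> X \<times> X"
      by (auto simp: small_entourages_def entourage_def)
    show "X \<times> X \<subseteq> \<Union>(small_entourages K X)"
    proof
      fix p assume "p \<in> X \<times> X"
      then show "p \<in> \<Union>(small_entourages K X)"
        using finite_Un_Id_on_small_entourages[of "{p}" X K] by blast
    qed
  qed
  show "\<exists>G\<in>small_entourages K X. E O F\<inverse> \<subseteq> G"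
    if "E \<in> small_entourages K X" "F \<in> small_entourages K X" for E F
  proof -
    have ent: "entourage X E" "entourage X F"
      using that by (auto simp: small_entourages_def)
    then have sub: "E \<subseteq> X \<times> X" "F \<subseteq> X \<times> X" "F\<inverse> \<subseteq> X \<times> X"
      by (auto simp: entourage_def)
    have "uniformly_finite_on X (E O F\<inverse>)"
      using that sub by (intro uniformly_finite_on_relcomp) (auto simp: small_entourages_def)
    moreover have "uniformly_finite_on X (F O E\<inverse>)"
      using that sub by (intro uniformly_finite_on_relcomp) (auto simp: small_entourages_def)
    moreover have "(E O F\<inverse>)\<inverse> = F O E\<inverse>"
      by auto
    moreover have "small_at_infinity K (E O F\<inverse>)"
      using that sub
      by (intro small_at_infinity_relcomp[where X = X] small_at_infinity_converse)
        (auto simp: small_entourages_def)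
    moreover have "entourage X (E O F\<inverse>)"
      using ent unfolding entourage_def by blast
    ultimately have "E O F\<inverse> \<in> small_entourages K X"
      by (simp add: small_entourages_def)
    then show ?thesis
      by blast
  qed
  show "E \<in> small_entourages K X" if F: "F \<in> small_entourages K X" and EF: "Id_on X \<subseteq> E \<and> E \<subseteq> F" for E F
  proof -
    have "small_at_infinity K E"
      unfolding small_at_infinity_def
    proof (intro allI impI)
      fix g and \<epsilon> :: real
      assume "continuous_map K euclideanreal g" "\<epsilon> > 0"
      then have "finite {(x, y). (x, y) \<in> F \<and> \<epsilon> \<le> \<bar>g x - g y\<bar>}"
        using F by (simp add: small_entourages_def small_at_infinity_def)
      then show "finite {(x, y). (x, y) \<in> E \<and> \<epsilon> \<le> \<bar>g x - g y\<bar>}"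
        by (rule rev_finite_subset) (use EF in auto)
    qed
    moreover have "E\<inverse> \<subseteq> F\<inverse>"
      using EF by auto
    ultimately show ?thesis
      using F EF uniformly_finite_on_subset
      unfolding small_entourages_def entourage_def by blast
  qed
qed

lemma finitary_small_entourages: "finitary X (small_entourages K X)"
  by (auto simp: finitary_def small_entourages_def uniformly_finite_on_def)

text \<open>Bounded sets lie in the ball of some point, so there are none at all if \<open>X\<close> is empty.\<close>

lemma finite_imp_coarsely_bounded_small_entourages:
  assumes "finite S" "S \<subseteq> X" "X \<noteq> {}"
  shows "coarsely_bounded X (small_entourages K X) S"
proof -
  obtain x where "x \<in> X"
    using assms(3) by blast
  then have "Id_on X \<union> {x} \<times> S \<in> small_entourages K X"
    using assms by (intro finite_Un_Id_on_small_entourages) auto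
  moreover have "S \<subseteq> (Id_on X \<union> {x} \<times> S) `` {x}"
    by auto
  ultimately show ?thesis
    unfolding coarsely_bounded_def using assms(2) \<open>x \<in> X\<close> by blast
qed

lemma finitary_coarsely_bounded_imp_finite:
  assumes "finitary X \<E>" "coarsely_bounded X \<E> B"
  shows "finite B"
proof -
  obtain E x where "E \<in> \<E>" "x \<in> X" "B \<subseteq> E `` {x}"
    using assms(2) unfolding coarsely_bounded_def by blast
  then show ?thesis
    using assms(1) unfolding finitary_def by (meson finite_subset)
qed

section \<open>Continuous functions oscillate slowly\<close>

text \<open>
  The exceptional bounded set consists of the first components of the finitely many pairs along
  which \<open>g\<close> changes by at least \<open>\<epsilon>/4\<close>; outside it, any two values on a ball differ by at most \<open>\<epsilon>/2\<close>.
\<close>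

lemma continuous_slowly_oscillating:
  assumes g: "continuous_map K euclideanreal g" and "X \<noteq> {}"
    and eq: "\<And>x. x \<in> X \<Longrightarrow> \<phi> x = g x"
  shows "slowly_oscillating X (small_entourages K X) \<phi>"
  unfolding slowly_oscillating_def
proof (intro allI impI ballI)
  fix \<epsilon> :: real and E
  assume "\<epsilon> > 0" and E: "E \<in> small_entourages K X"
  let ?bad = "{(x, y). (x, y) \<in> E \<and> \<epsilon> / 4 \<le> \<bar>g x - g y\<bar>}"
  let ?B = "fst ` ?bad"
  have EX: "E \<subseteq> X \<times> X"
    using E by (simp add: small_entourages_def entourage_def)
  have "finite ?bad"
  proof (rule small_at_infinityD[OF _ g])
    show "small_at_infinity K E"
      using E by (simp add: small_entourages_def)
  qed (use \<open>\<epsilon> > 0\<close> in simp)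
  then have "coarsely_bounded X (small_entourages K X) ?B"
    using EX \<open>X \<noteq> {}\<close> by (intro finite_imp_coarsely_bounded_small_entourages) auto
  moreover have "bounded (\<phi> ` (E `` {x})) \<and> diameter (\<phi> ` (E `` {x})) < \<epsilon>" if x: "x \<in> X - ?B" for x
  proof
    have "finite (E `` {x})"
      using E x by (auto simp: small_entourages_def uniformly_finite_on_def)
    then show "bounded (\<phi> ` (E `` {x}))"
      by (simp add: finite_imp_bounded)
    have near: "\<bar>g x - \<phi> y\<bar> < \<epsilon> / 4" if "y \<in> E `` {x}" for y
    proof -
      have "y \<in> X" "(x, y) \<notin> ?bad"
        using EX x that by force+
      then show ?thesis
        using that eq by auto
    qed
    have "diameter (\<phi> ` (E `` {x})) \<le> \<epsilon> / 2"
    proof (rule diameter_le)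
      show "norm (a - b) \<le> \<epsilon> / 2" if "a \<in> \<phi> ` (E `` {x})" "b \<in> \<phi> ` (E `` {x})" for a b
      proof -
        obtain y z where "a = \<phi> y" "b = \<phi> z" "y \<in> E `` {x}" "z \<in> E `` {x}"
          using \<open>a \<in> \<phi> ` (E `` {x})\<close> \<open>b \<in> \<phi> ` (E `` {x})\<close> by blast
        then show ?thesis
          using near[of y] near[of z] unfolding real_norm_def by linarith
      qed
    qed (use \<open>\<epsilon> > 0\<close> in simp)
    then show "diameter (\<phi> ` (E `` {x})) < \<epsilon>"
      using \<open>\<epsilon> > 0\<close> by linarith
  qed
  ultimately show "\<exists>B. coarsely_bounded X (small_entourages K X) B \<and>
      (\<forall>x\<in>X - B. bounded (\<phi> ` (E `` {x})) \<and> diameter (\<phi> ` (E `` {x})) < \<epsilon>)"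
    by blast
qed

section \<open>Slowly oscillating functions extend continuously\<close>

text \<open>
  In a \<open>T\<^sub>1\<close> space a sequence in \<open>A\<close> that converges to a point outside \<open>A\<close> has infinite range, because
  a finite range would be closed. So it suffices to keep each of its values at its first occurrence.
\<close>

lemma frechet_urysohn_injective_sequence:
  assumes "frechet_urysohn_space K" "t1_space K"
    and "A \<subseteq> topspace K" "p \<in> K closure_of A" "p \<notin> A"
  obtains a :: "nat \<Rightarrow> 'a" where "inj a" "range a \<subseteq> A" "limitin K a p sequentially"
proof -
  obtain \<sigma> :: "nat \<Rightarrow> 'a" where \<sigma>: "range \<sigma> \<subseteq> A" "limitin K \<sigma> p sequentially"
    using assms unfolding frechet_urysohn_space_def by blast
  have "infinite (range \<sigma>)"
  proof
    assume fin: "finite (range \<sigma>)"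
    have "closedin K (range \<sigma>)"
      using assms(2,3) \<sigma>(1) fin t1_space_closedin_finite by blast
    then have "openin K (topspace K - range \<sigma>)"
      by blast
    moreover have "p \<in> topspace K - range \<sigma>"
      using \<sigma> assms(5) limitin_topspace by fast
    ultimately have "eventually (\<lambda>n. \<sigma> n \<in> topspace K - range \<sigma>) sequentially"
      using \<sigma>(2) unfolding limitin_def by blast
    then show False
      by (auto simp: eventually_sequentially)
  qed
  define N where "N = {n. \<forall>m<n. \<sigma> m \<noteq> \<sigma> n}"
  have "range \<sigma> \<subseteq> \<sigma> ` N"
  proof clarify
    fix n
    let ?m = "LEAST m. \<sigma> m = \<sigma> n"
    have "\<sigma> ?m = \<sigma> n"
      by (rule LeastI) simp
    moreover have "?m \<in> N"
      unfolding N_def using calculation not_less_Least by fastforce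
    ultimately show "\<sigma> n \<in> \<sigma> ` N"
      by (metis image_eqI)
  qed
  then have "infinite N"
    using \<open>infinite (range \<sigma>)\<close> finite_surj by blast
  have "inj_on \<sigma> N"
    unfolding N_def inj_on_def by (metis (mono_tags, lifting) linorder_neqE_nat mem_Collect_eq)
  have mono: "strict_mono (enumerate N)"
    using \<open>infinite N\<close> by (simp add: strict_mono_enumerate)
  have "inj (\<sigma> \<circ> enumerate N)"
    using \<open>inj_on \<sigma> N\<close> \<open>infinite N\<close> mono
    by (intro comp_inj_on strict_mono_imp_inj_on) (auto simp: range_enumerate)
  moreover have "limitin K (\<sigma> \<circ> enumerate N) p sequentially"
    using limitin_subsequence[OF mono \<sigma>(2)] .
  moreover have "range (\<sigma> \<circ> enumerate N) \<subseteq> A"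
    using \<sigma>(1) by auto
  ultimately show thesis
    using that by blast
qed

text \<open>
  Injectivity of both sequences adds at most one point to each ball of the relation and of its
  converse. Continuous functions have the same limit along both sequences, which is smallness at
  infinity.
\<close>

lemma paired_sequences_entourage:
  fixes a b :: "nat \<Rightarrow> 'a"
  assumes "inj a" "range a \<subseteq> X" "limitin K a p sequentially"
    and "inj b" "range b \<subseteq> X" "limitin K b p sequentially"
  shows "Id_on X \<union> range (\<lambda>n. (a n, b n)) \<in> small_entourages K X"
proof -
  have uf: "uniformly_finite_on X (Id_on X \<union> range (\<lambda>n. (u n, v n)))" if "inj u" for u v :: "nat \<Rightarrow> 'a"
    unfolding uniformly_finite_on_def
  proof (intro exI ballI)
    fix x assume "x \<in> X"
    let ?S = "(Id_on X \<union> range (\<lambda>n. (u n, v n))) `` {x}"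
    have sub: "?S \<subseteq> {x, v (inv u x)}"
      using that by auto
    then have "card ?S \<le> card {x, v (inv u x)}"
      by (intro card_mono) auto
    also have "\<dots> \<le> 2"
      by (simp add: card_insert_if)
    finally show "finite ?S \<and> card ?S \<le> 2"
      using sub by (meson finite.emptyI finite.insertI finite_subset)
  qed
  have conv: "(Id_on X \<union> range (\<lambda>n. (a n, b n)))\<inverse> = Id_on X \<union> range (\<lambda>n. (b n, a n))"
    by (rule set_eqI) (auto simp: image_iff)
  have "small_at_infinity K (Id_on X \<union> range (\<lambda>n. (a n, b n)))"
    unfolding small_at_infinity_def
  proof (intro allI impI)
    fix g and \<epsilon> :: real
    assume g: "continuous_map K euclideanreal g" and "\<epsilon> > 0"
    have "(\<lambda>n. g (a n)) \<longlonglongrightarrow> g p" "(\<lambda>n. g (b n)) \<longlonglongrightarrow> g p"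
      using continuous_map_limit[OF g] assms(3,6) by (simp_all add: comp_def)
    then have "(\<lambda>n. g (a n) - g (b n)) \<longlonglongrightarrow> g p - g p"
      by (rule tendsto_diff)
    then have "eventually (\<lambda>n. \<bar>g (a n) - g (b n)\<bar> < \<epsilon>) sequentially"
      using \<open>\<epsilon> > 0\<close> by (auto simp: tendsto_iff dist_real_def)
    then obtain m where m: "\<And>n. n \<ge> m \<Longrightarrow> \<bar>g (a n) - g (b n)\<bar> < \<epsilon>"
      unfolding eventually_sequentially by blast
    have "{(x, y). (x, y) \<in> Id_on X \<union> range (\<lambda>n. (a n, b n)) \<and> \<epsilon> \<le> \<bar>g x - g y\<bar>}
        \<subseteq> (\<lambda>n. (a n, b n)) ` {..<m}"
      using m \<open>\<epsilon> > 0\<close> by (force simp: not_le[symmetric])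
    then show "finite {(x, y). (x, y) \<in> Id_on X \<union> range (\<lambda>n. (a n, b n)) \<and> \<epsilon> \<le> \<bar>g x - g y\<bar>}"
      by (rule finite_subset) simp
  qed
  moreover have "entourage X (Id_on X \<union> range (\<lambda>n. (a n, b n)))"
    using assms by (auto simp: entourage_def)
  ultimately show ?thesis
    using uf[OF assms(1), of b] uf[OF assms(4), of a] by (simp add: small_entourages_def conv)
qed

text \<open>
  By the previous lemma, a slowly oscillating function cannot keep a distance between its values
  on two sets that both accumulate at a point outside \<open>X\<close>.
\<close>

lemma slowly_oscillating_common_accumulation:
  assumes K: "frechet_urysohn_space K" "t1_space K"
    and X: "X \<subseteq> topspace K" "p \<notin> X"
    and so: "slowly_oscillating X (small_entourages K X) \<phi>"
    and A: "A \<subseteq> X" "p \<in> K closure_of A"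
    and B: "B \<subseteq> X" "p \<in> K closure_of B"
    and "\<delta> > 0"
  shows "\<exists>x\<in>A. \<exists>y\<in>B. \<bar>\<phi> x - \<phi> y\<bar> < \<delta>"
proof -
  obtain a :: "nat \<Rightarrow> 'a" where a: "inj a" "range a \<subseteq> A" "limitin K a p sequentially"
    using frechet_urysohn_injective_sequence[OF K, of A p] A X by blast
  obtain b :: "nat \<Rightarrow> 'a" where b: "inj b" "range b \<subseteq> B" "limitin K b p sequentially"
    using frechet_urysohn_injective_sequence[OF K, of B p] B X by blast
  let ?E = "Id_on X \<union> range (\<lambda>n. (a n, b n))"
  have "?E \<in> small_entourages K X"
    using a b A(1) B(1) by (intro paired_sequences_entourage[where p = p]) auto
  then obtain C where C: "coarsely_bounded X (small_entourages K X) C"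
    and osc: "\<And>x. x \<in> X - C \<Longrightarrow> bounded (\<phi> ` (?E `` {x})) \<and> diameter (\<phi> ` (?E `` {x})) < \<delta>"
    using so \<open>\<delta> > 0\<close> unfolding slowly_oscillating_def by meson
  have "finite C"
    using finitary_coarsely_bounded_imp_finite[OF finitary_small_entourages C] .
  then have "\<not> range a \<subseteq> C"
    using a(1) by (meson finite_subset range_inj_infinite)
  then obtain n where "a n \<notin> C"
    by blast
  moreover have "a n \<in> X"
    using a(2) A(1) by blast
  ultimately have bd: "bounded (\<phi> ` (?E `` {a n}))" "diameter (\<phi> ` (?E `` {a n})) < \<delta>"
    using osc by auto
  have "\<phi> (a n) \<in> \<phi> ` (?E `` {a n})" "\<phi> (b n) \<in> \<phi> ` (?E `` {a n})"
    using \<open>a n \<in> X\<close> by auto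
  then have "dist (\<phi> (a n)) (\<phi> (b n)) \<le> diameter (\<phi> ` (?E `` {a n}))"
    by (rule diameter_bounded_bound[OF bd(1)])
  then have "\<bar>\<phi> (a n) - \<phi> (b n)\<bar> < \<delta>"
    using bd(2) by (simp add: dist_real_def)
  then show ?thesis
    using a(2) b(2) by blast
qed

text \<open>
  Boundedness provides a cluster value \<open>l\<close> of \<open>\<phi>\<close> at \<open>p\<close>. Were it not the limit, the points with
  value within \<open>\<epsilon>/2\<close> of \<open>l\<close> and those with value \<open>\<epsilon>\<close>-far from \<open>l\<close> would both accumulate at \<open>p\<close>.
\<close>

lemma slowly_oscillating_limit:
  assumes K: "frechet_urysohn_space K" "t1_space K"
    and X: "X \<subseteq> topspace K" "p \<in> K closure_of X" "p \<notin> X"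
    and so: "slowly_oscillating X (small_entourages K X) \<phi>" and bdd: "bounded (\<phi> ` X)"
  shows "\<exists>l. limitin euclideanreal \<phi> l (atin_within K p X)"
proof -
  let ?F = "atin_within K p X"
  have pK: "p \<in> topspace K"
    using X(2) by (simp add: in_closure_of)
  have closure_iff: "p \<in> K closure_of {x \<in> X. P x} \<longleftrightarrow> \<not> eventually (\<lambda>x. \<not> P x) ?F" for P
  proof -
    have "eventually (\<lambda>x. \<not> P x) ?F \<longleftrightarrow> (\<exists>T. openin K T \<and> p \<in> T \<and> (\<forall>x\<in>T. x \<in> X \<longrightarrow> \<not> P x))"
      using X(3) pK unfolding eventually_atin_within by metis
    then show ?thesis
      using pK by (auto simp: in_closure_of)
  qed
  obtain M where M: "\<And>x. x \<in> X \<Longrightarrow> \<phi> x \<in> cball 0 M"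
    using bdd by (auto simp: bounded_iff)
  have "?F \<noteq> bot"
    using closure_iff[of "\<lambda>_. True"] X(2) by (auto simp: trivial_limit_def)
  then have "filtermap \<phi> ?F \<noteq> bot"
    by (simp add: filtermap_bot_iff)
  moreover have "eventually (\<lambda>v. v \<in> cball 0 M) (filtermap \<phi> ?F)"
    using M pK openin_topspace unfolding eventually_filtermap eventually_atin_within by blast
  ultimately obtain l where l: "inf (nhds l) (filtermap \<phi> ?F) \<noteq> bot"
    using compact_cball compact_filter[of "cball 0 M"] by blast
  have cluster: "p \<in> K closure_of {x \<in> X. dist (\<phi> x) l < e}" if "e > 0" for e
  proof -
    have "eventually (\<lambda>v. dist v l < e) (nhds l)"
      using that eventually_nhds_metric by blast
    then have "\<not> eventually (\<lambda>v. \<not> dist v l < e) (filtermap \<phi> ?F)"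
      using l unfolding trivial_limit_def eventually_inf by blast
    then show ?thesis
      unfolding closure_iff eventually_filtermap .
  qed
  have "(\<phi> \<longlongrightarrow> l) ?F"
    unfolding tendsto_iff
  proof (intro allI impI)
    fix e :: real assume "e > 0"
    show "eventually (\<lambda>x. dist (\<phi> x) l < e) ?F"
    proof (rule ccontr)
      assume "\<not> eventually (\<lambda>x. dist (\<phi> x) l < e) ?F"
      then have far: "p \<in> K closure_of {x \<in> X. \<not> dist (\<phi> x) l < e}"
        unfolding closure_iff by simp
      have "p \<in> K closure_of {x \<in> X. dist (\<phi> x) l < e / 2}"
        using cluster[of "e / 2"] \<open>e > 0\<close> by simp
      then have "\<exists>x\<in>{x \<in> X. dist (\<phi> x) l < e / 2}. \<exists>y\<in>{x \<in> X. \<not> dist (\<phi> x) l < e}.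
          \<bar>\<phi> x - \<phi> y\<bar> < e / 2"
        using \<open>e > 0\<close>
        by (intro slowly_oscillating_common_accumulation[OF K X(1,3) so _ _ _ far]) auto
      then obtain x y where "dist (\<phi> x) l < e / 2" "\<not> dist (\<phi> y) l < e" "\<bar>\<phi> x - \<phi> y\<bar> < e / 2"
        by blast
      then show False
        unfolding dist_real_def by linarith
    qed
  qed
  then show ?thesis
    by auto
qed

text \<open>
  The isolated points form a discrete open subspace, so continuity is only at stake at the other
  points. There pointwise limits suffice, since the real line is regular.
\<close>

lemma slowly_oscillating_extends:
  assumes K: "frechet_urysohn_space K" "t1_space K"
    and dense: "K closure_of (isolated_points K) = topspace K"
    and so: "slowly_oscillating (isolated_points K) (small_entourages K (isolated_points K)) \<phi>"
    and bdd: "bounded (\<phi> ` isolated_points K)"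
  shows "\<exists>g. continuous_map K euclideanreal g \<and> (\<forall>x\<in>isolated_points K. g x = \<phi> x)"
proof -
  let ?X = "isolated_points K"
  have X: "?X \<subseteq> topspace K"
    by (auto simp: isolated_points_def)
  have sub_open: "openin K S" if "S \<subseteq> ?X" for S
  proof -
    have "openin K (\<Union>x\<in>S. {x})"
      using that by (intro openin_Union) (auto simp: isolated_points_def)
    then show ?thesis
      by simp
  qed
  have "continuous_map (subtopology K ?X) euclideanreal \<phi>"
    unfolding continuous_map_def openin_open_subtopology[OF sub_open[OF order_refl]]
    by (auto intro: sub_open)
  moreover have "\<exists>l. limitin euclideanreal \<phi> l (atin_within K p ?X)" if "p \<in> topspace K - ?X" for p
    using that dense by (intro slowly_oscillating_limit[OF K X _ _ so bdd]) auto
  ultimately obtain g where "continuous_map (subtopology K (topspace K)) euclideanreal g"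
      "\<And>x. x \<in> ?X \<Longrightarrow> g x = \<phi> x"
    using continuous_map_extension_pointwise_alt[of euclideanreal ?X "topspace K" K \<phi>] X dense
    by (metis order_refl regular_space_euclidean)
  then show ?thesis
    by auto
qed

section \<open>The Higson compactification\<close>

theorem corollary7p9:
  fixes K :: "'a topology"
  assumes "compact_space K"
    and "Hausdorff_space K"
    and "frechet_urysohn_space K"
    and "K closure_of (isolated_points K) = topspace K"
  shows "\<exists>(X :: 'a set) \<E>. coarse_space X \<E> \<and> finitary X \<E> \<and>
           K homeomorphic_space (higson_compactification X \<E>)"
proof -
  let ?X = "isolated_points K"
  let ?E = "small_entourages K ?X"
  let ?SO = "so_functions ?X ?E"
  let ?P = "product_topology (\<lambda>_. euclideanreal) ?SO"
  have X: "?X \<subseteq> topspace K"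
    by (auto simp: isolated_points_def)
  have "t1_space K"
    using assms(2) by (rule Hausdorff_imp_t1_space)
  then have "\<exists>g. continuous_map K euclideanreal g \<and> (\<forall>x\<in>?X. g x = f x)" if "f \<in> ?SO" for f
    using that assms(3,4) by (intro slowly_oscillating_extends) (auto simp: so_functions_def)
  then obtain ext where ext: "\<And>f. f \<in> ?SO \<Longrightarrow> continuous_map K euclideanreal (ext f)"
    and ext_eq: "\<And>f x. f \<in> ?SO \<Longrightarrow> x \<in> ?X \<Longrightarrow> ext f x = f x"
    by metis
  define h where "h = (\<lambda>p. \<lambda>f\<in>?SO. ext f p)"
  have h_cont: "continuous_map K ?P h"
    unfolding h_def continuous_map_componentwise using ext by auto
  have haus: "Hausdorff_space ?P"
    by (simp add: Hausdorff_space_product_topology)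
  \<comment> \<open>A continuous function separating \<open>p\<close> and \<open>q\<close> restricts to one of the coordinates, and by density
    of \<open>X\<close> it is the extension chosen for that coordinate.\<close>
  have "inj_on h (topspace K)"
  proof (rule inj_onI, rule ccontr)
    fix p q
    assume pq: "p \<in> topspace K" "q \<in> topspace K" "h p = h q" "p \<noteq> q"
    have "normal_space K"
      using assms(1,2) compact_Hausdorff_or_regular_imp_normal_space by blast
    then obtain g where "continuous_map K (top_of_set {0..1::real}) g" and g01: "g ` {p} \<subseteq> {0}" "g ` {q} \<subseteq> {1}"
      using pq closedin_t1_singleton[OF \<open>t1_space K\<close>]
        Urysohn_lemma[of K "{p}" "{q}" 0 1] by auto
    then have g: "continuous_map K euclideanreal g"
      by (simp add: continuous_map_in_subtopology)
    have "compact (g ` topspace K)"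
      using image_compactin[OF _ g, of "topspace K"] assms(1) by (simp add: compact_space_def)
    then have "bounded (restrict g ?X ` ?X)"
      using X by (auto intro: bounded_subset[OF compact_imp_bounded])
    moreover have "?X \<noteq> {}"
      using assms(4) pq(1) by auto
    ultimately have so: "restrict g ?X \<in> ?SO"
      using continuous_slowly_oscillating[OF g] by (auto simp: so_functions_def)
    have ext_g: "ext (restrict g ?X) x = g x" if "x \<in> topspace K" for x
      using that forall_in_closure_of_eq[of x K ?X euclideanreal "ext (restrict g ?X)" g]
        assms(4) ext[OF so] ext_eq[OF so] g by simp
    have "ext (restrict g ?X) p = ext (restrict g ?X) q"
      using fun_cong[OF pq(3), of "restrict g ?X"] so by (simp add: h_def)
    then show False
      using ext_g pq(1,2) g01 by auto
  qed
  then have "embedding_map K ?P h"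
    using continuous_imp_embedding_map[OF h_cont assms(1) haus] by blast
  then have "K homeomorphic_space subtopology ?P (h ` topspace K)"
    by (rule embedding_map_imp_homeomorphic_space)
  moreover have "h ` topspace K = ?P closure_of (higson_map ?X ?E ` ?X)"
  proof -
    have hX: "higson_map ?X ?E ` ?X = h ` ?X"
      using ext_eq by (intro image_cong) (auto simp: higson_map_def h_def)
    have "compactin ?P (h ` topspace K)"
      using image_compactin[OF _ h_cont] assms(1) by (simp add: compact_space_def)
    then have "closedin ?P (h ` topspace K)"
      by (rule compactin_imp_closedin[OF haus])
    then have "?P closure_of (h ` ?X) \<subseteq> h ` topspace K"
      using X by (intro closure_of_minimal) auto
    moreover have "h ` topspace K \<subseteq> ?P closure_of (h ` ?X)"
      using continuous_map_image_closure_subset[OF h_cont, of ?X] assms(4) by simp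
    ultimately show ?thesis
      unfolding hX by blast
  qed
  ultimately have "K homeomorphic_space higson_compactification ?X ?E"
    by (simp add: higson_compactification_def Let_def)
  then show ?thesis
    using coarse_space_small_entourages finitary_small_entourages by blast
qed

end
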